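(* Let $\alpha,\beta,\gamma,m_0,m_1\in\mathbb{R}$ with $\alpha m_1>0$. For $u=(x,y,z)\in\mathbb{R}^3$ let $J(u)=\begin{pmatrix}\alpha(m_0-1)-3\alpha m_1x^2&\alpha&0\\1&-1&1\\0&\beta&-\gamma\end{pmatrix}$, and let $\lambda_1(u)\ge\lambda_2(u)\ge\lambda_3(u)$ be the eigenvalues, counted with multiplicity, of the symmetric matrix $\tfrac12\big(J(u)+J(u)^{*}\big)$. Then for every $u\in\mathbb{R}^3$, $$d_{\rm L}^{\rm KY}\big(\{\lambda_j(u)\}_{j=1}^3\big)\le d_{\rm L}^{\rm KY}\big(\{\lambda_j(0)\}_{j=1}^3\big),$$ where $\lambda_j(0)$ denotes the value of $\lambda_j$ at $u=(0,0,0)$ and $d_{\rm L}^{\rm KY}$ is the Kaplan-Yorke formula.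
   Context: $J(u)$ is the Jacobian matrix of the right-hand side of the Chua memristor system $\dot x=\alpha(m_0-1)x+\alpha y-\alpha m_1x^3+\alpha x_0$, $\dot y=x-y+z$, $\dot z=\beta y-\gamma z$, with real parameters $\alpha,\beta,\gamma,m_0,m_1,x_0$. The star denotes the transpose. Kaplan-Yorke formula: for real numbers $\lambda_1\ge\lambda_2\ge\lambda_3$ let $j=\max\{m\in\{0,1,2,3\}:\sum_{i=1}^m\lambda_i\ge0\}$ (the empty sum being $0$). Then $d_{\rm L}^{\rm KY}(\{\lambda_i\}_{i=1}^3)=0$ if $j=0$, $d_{\rm L}^{\rm KY}(\{\lambda_i\}_{i=1}^3)=3$ if $j=3$, and otherwise $$d_{\rm L}^{\rm KY}(\{\lambda_i\}_{i=1}^3)=j+\frac{\sum_{i=1}^j\lambda_i}{|\lambda_{j+1}|}.$$ *)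

theory Defs
  imports Complex_Main "Jordan_Normal_Form.Char_Poly"
begin

fun chua_jacobian ::
  "real \<Rightarrow> real \<Rightarrow> real \<Rightarrow> real \<Rightarrow> real \<Rightarrow> real \<times> real \<times> real \<Rightarrow> real mat" where
  "chua_jacobian \<alpha> \<beta> \<gamma> m0 m1 (x, y, z) = mat_of_rows_list 3
     [[\<alpha> * (m0 - 1) - 3 * \<alpha> * m1 * x\<^sup>2, \<alpha>,  0],
      [1,                                -1, 1],
      [0,                                \<beta>,  - \<gamma>]]"

definition sym_part :: "real mat \<Rightarrow> real mat" where
  "sym_part A = (1 / 2) \<cdot>\<^sub>m (A + transpose_mat A)"

(* The real eigenvalues in nonincreasing order, repeated according to multiplicity: proots p
   is the multiset of roots of p, each with its multiplicity.  A real symmetric n x n matrix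
   has exactly n of them, and for such a matrix algebraic and geometric multiplicity agree. *)
definition eigenvalues_desc :: "real mat \<Rightarrow> real list" where
  "eigenvalues_desc A = rev (sorted_list_of_multiset (proots (char_poly A)))"

(* Eigenvalues are numbered from 1, lists from 0; only i = 1, 2, 3 is ever used. *)
definition chua_eigenvalue ::
  "real \<Rightarrow> real \<Rightarrow> real \<Rightarrow> real \<Rightarrow> real \<Rightarrow> real \<times> real \<times> real \<Rightarrow> nat \<Rightarrow> real" where
  "chua_eigenvalue \<alpha> \<beta> \<gamma> m0 m1 u i =
     eigenvalues_desc (sym_part (chua_jacobian \<alpha> \<beta> \<gamma> m0 m1 u)) ! (i - 1)"

(* The argument stands for a triple l 1 \<ge> l 2 \<ge> l 3; values at other indices play no role. *)
definition KY_index :: "(nat \<Rightarrow> real) \<Rightarrow> nat" where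
  "KY_index l = Max {m \<in> {0, 1, 2, 3}. (\<Sum>i = 1..m. l i) \<ge> 0}"

definition KY_dim :: "(nat \<Rightarrow> real) \<Rightarrow> real" where
  "KY_dim l =
     (let j = KY_index l in
      if j = 0 then 0
      else if j = 3 then 3
      else real j + (\<Sum>i = 1..j. l i) / \<bar>l (j + 1)\<bar>)"

end

theory Submission
  imports Defs
begin

text \<open>
  Replacing the origin by \<open>u\<close> subtracts \<open>t = 3 \<alpha> m\<^sub>1 x\<^sup>2 \<ge> 0\<close> from the \<open>(1,1)\<close> entry of the
  symmetrised Jacobian, so its characteristic polynomial changes from \<open>p\<close> to \<open>p + t q\<close>, where
  \<open>q\<close> is the characteristic polynomial of the fixed lower right \<open>2 \<times> 2\<close> block. The roots of both
  cubics interlace those of \<open>q\<close>, and comparing signs between consecutive roots shows that every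
  eigenvalue can only decrease. The Kaplan-Yorke dimension is monotone in each eigenvalue: it is
  the last point of \<open>[0, 3]\<close> at which the piecewise linear interpolation of the partial sums is
  nonnegative.
\<close>

section \<open>Monotonicity of the Kaplan-Yorke dimension\<close>

lemma sum_upto3:
  fixes l :: "nat \<Rightarrow> real"
  shows "(\<Sum>i = 1..0. l i) = 0" "(\<Sum>i = 1..1. l i) = l 1" "(\<Sum>i = 1..2. l i) = l 1 + l 2"
    "(\<Sum>i = 1..3. l i) = l 1 + l 2 + l 3"
  by (simp_all add: numeral_eq_Suc)

text \<open>The maximal index is the first success when the partial sums are tested from
  \<open>3\<close> downwards; this turns \<open>Max\<close> into a plain case distinction.\<close>

lemma KY_dim_cases:
  "KY_dim l =
     (if l 1 + l 2 + l 3 \<ge> 0 then 3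
      else if l 1 + l 2 \<ge> 0 then 2 + (l 1 + l 2) / \<bar>l 3\<bar>
      else if l 1 \<ge> 0 then 1 + l 1 / \<bar>l 2\<bar>
      else 0)"
proof -
  have "{m \<in> {0, 1, 2, 3}. (\<Sum>i = 1..m. l i) \<ge> 0} =
      {0} \<union> (if l 1 \<ge> 0 then {1} else {}) \<union> (if l 1 + l 2 \<ge> 0 then {2} else {})
        \<union> (if l 1 + l 2 + l 3 \<ge> 0 then {3} else {})"
    using sum_upto3[of l] by (auto simp del: sum.cl_ivl_Suc One_nat_def)
  then have "KY_index l =
      (if l 1 + l 2 + l 3 \<ge> 0 then 3 else if l 1 + l 2 \<ge> 0 then 2 else if l 1 \<ge> 0 then 1 else 0)"
    unfolding KY_index_def by (auto simp: Max_insert)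
  then show ?thesis
    unfolding KY_dim_def Let_def using sum_upto3[of l]
    by (auto simp del: sum.cl_ivl_Suc simp: numeral_2_eq_2 numeral_3_eq_3)
qed

text \<open>Both \<open>a\<close> and \<open>a'\<close> are negative here, so passing to the primed
  values enlarges the numerator and shrinks the denominator.\<close>

lemma divide_abs_mono:
  fixes s s' a a' :: real
  assumes "s \<le> s'" "a \<le> a'" "s \<ge> 0" "s + a < 0" "s' + a' < 0"
  shows "s / \<bar>a\<bar> \<le> s' / \<bar>a'\<bar>"
  using assms by (intro frac_le) auto

text \<open>Larger entries give larger partial sums, so \<open>l\<close> falls into the same branch
  of \<open>KY_dim_cases\<close> as \<open>k\<close> or a higher one. Within a branch
  \<open>divide_abs_mono\<close> applies; across branches it suffices that each fraction lies in
  \<open>[0, 1]\<close>.\<close>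

lemma KY_dim_mono:
  assumes "k 1 \<le> l 1" "k 2 \<le> l 2" "k 3 \<le> l 3"
  shows "KY_dim k \<le> KY_dim l"
proof -
  have bound: "0 \<le> s / \<bar>a\<bar>" "s / \<bar>a\<bar> \<le> 1" if "s \<ge> 0" "s + a < 0" for s a :: real
    using that by (auto simp: divide_simps)
  show ?thesis
    using assms bound[of "k 1" "k 2"] bound[of "k 1 + k 2" "k 3"] bound[of "l 1" "l 2"]
      bound[of "l 1 + l 2" "l 3"] divide_abs_mono[of "k 1" "l 1" "k 2" "l 2"]
      divide_abs_mono[of "k 1 + k 2" "l 1 + l 2" "k 3" "l 3"]
    unfolding KY_dim_cases by (auto split: if_splits)
qed

section \<open>Interlacing for a bordered cubic\<close>

text \<open>Completing the square turns the hypothesis into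
  \<open>(2 * \<mu> + b)\<^sup>2 \<le> b\<^sup>2 - 4 * c\<close>: the discriminant is nonnegative
  and \<mu> lies between the roots.\<close>

lemma monic_quadratic_roots:
  fixes b c \<mu> :: real
  assumes "\<mu>\<^sup>2 + b * \<mu> + c \<le> 0"
  obtains h1 h2 where "h1 \<ge> \<mu>" "\<mu> \<ge> h2" "\<And>x. x\<^sup>2 + b * x + c = (x - h1) * (x - h2)"
proof
  define s where "s = sqrt (b\<^sup>2 - 4 * c)"
  have "(2 * \<mu> + b)\<^sup>2 \<le> b\<^sup>2 - 4 * c"
    using assms by (simp add: power2_eq_square algebra_simps)
  then have "\<bar>2 * \<mu> + b\<bar> \<le> s"
    unfolding s_def using real_le_rsqrt[of "\<bar>2 * \<mu> + b\<bar>"] by simp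
  then show "(- b + s) / 2 \<ge> \<mu>" "\<mu> \<ge> (- b - s) / 2"
    by auto
  have "0 \<le> b\<^sup>2 - 4 * c"
    using \<open>(2 * \<mu> + b)\<^sup>2 \<le> b\<^sup>2 - 4 * c\<close> zero_le_power2[of "2 * \<mu> + b"] by linarith
  then have "s * s = b\<^sup>2 - 4 * c"
    unfolding s_def by simp
  then show "x\<^sup>2 + b * x + c = (x - (- b + s) / 2) * (x - (- b - s) / 2)" for x
    by (simp add: field_simps power2_eq_square)
qed

lemma monic_cubic_root_ge:
  fixes A B C \<mu> :: real
  assumes "\<mu> ^ 3 + A * \<mu>\<^sup>2 + B * \<mu> + C \<le> 0"
  obtains r where "r \<ge> \<mu>" "r ^ 3 + A * r\<^sup>2 + B * r + C = 0"
proof -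
  define p where "p x = x ^ 3 + A * x\<^sup>2 + B * x + C" for x :: real
  \<comment> \<open>At \<open>M \<ge> 1\<close> the cube splits into multiples of
    \<open>M\<^sup>2\<close>, one absorbing each lower-order term; the summand
    \<open>\<bar>\<mu>\<bar>\<close> gives \<open>M \<ge> \<mu>\<close>. The intermediate value
    theorem then applies on \<open>{\<mu>..M}\<close>.\<close>
  define M where "M = 1 + \<bar>\<mu>\<bar> + \<bar>A\<bar> + \<bar>B\<bar> + \<bar>C\<bar>"
  have M: "M \<ge> 1" "M \<ge> \<mu>"
    by (auto simp: M_def)
  have "1 \<le> M\<^sup>2"
    using M by simp
  have "M \<le> M\<^sup>2"
    using M by (simp add: power2_eq_square)
  have "- \<bar>B\<bar> * M\<^sup>2 \<le> B * M"
  proof -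
    have "- (B * M) \<le> \<bar>B\<bar> * M"
      using M by (metis abs_ge_minus_self abs_mult abs_of_nonneg order.trans zero_le_one)
    also have "\<dots> \<le> \<bar>B\<bar> * M\<^sup>2"
      using \<open>M \<le> M\<^sup>2\<close> by (intro mult_left_mono) auto
    finally show ?thesis
      by simp
  qed
  moreover have "- \<bar>A\<bar> * M\<^sup>2 \<le> A * M\<^sup>2"
    by (intro mult_right_mono) auto
  moreover have "- \<bar>C\<bar> * M\<^sup>2 \<le> C"
  proof -
    have "\<bar>C\<bar> * 1 \<le> \<bar>C\<bar> * M\<^sup>2"
      using \<open>1 \<le> M\<^sup>2\<close> by (intro mult_left_mono) auto
    then show ?thesis
      by simp
  qed
  moreover have "M ^ 3 = (1 + \<bar>\<mu>\<bar>) * M\<^sup>2 + \<bar>A\<bar> * M\<^sup>2 + \<bar>B\<bar> * M\<^sup>2 + \<bar>C\<bar> * M\<^sup>2"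
    by (subst M_def) (simp add: M_def power2_eq_square power3_eq_cube algebra_simps)
  moreover have "0 \<le> (1 + \<bar>\<mu>\<bar>) * M\<^sup>2"
    by simp
  ultimately have "p M \<ge> 0"
    unfolding p_def by linarith
  have "p \<mu> \<le> 0"
    using assms by (simp add: p_def)
  have "continuous_on {\<mu>..M} p"
    unfolding p_def by (intro continuous_intros)
  then obtain r where "r \<ge> \<mu>" "p r = 0"
    using IVT'[of p \<mu> 0 M] \<open>p \<mu> \<le> 0\<close> \<open>p M \<ge> 0\<close> M by auto
  then show ?thesis
    using that by (simp add: p_def)
qed

text \<open>Cauchy interlacing for a border with a single nonzero entry, whose square is
  \<open>B\<close>. At \<open>\<mu>1\<close> and \<open>\<mu>2\<close> only
  \<open>- B * (x - g)\<close> survives, which fixes the signs there.\<close>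

lemma bordered_cubic_interlacing:
  fixes a B g \<mu>1 \<mu>2 :: real
  assumes "\<mu>1 \<ge> g" "g \<ge> \<mu>2" "B \<ge> 0"
  obtains l1 l2 l3 where "l1 \<ge> \<mu>1" "\<mu>1 \<ge> l2" "l2 \<ge> \<mu>2" "\<mu>2 \<ge> l3"
    "\<And>x. (x - a) * ((x - \<mu>1) * (x - \<mu>2)) - B * (x - g) = (x - l1) * (x - l2) * (x - l3)"
proof (cases "\<mu>1 = \<mu>2")
  \<comment> \<open>Now \<open>g\<close> is the double root, so \<open>x - g\<close> splits off, and
    the remaining quadratic takes the value \<open>- B\<close> at \<open>g\<close>.\<close>
  case True
  then have eq: "\<mu>1 = g" "\<mu>2 = g"
    using assms by auto
  have "g\<^sup>2 + (- a - g) * g + (a * g - B) \<le> 0"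
    using assms by (simp add: power2_eq_square algebra_simps)
  then obtain h1 h2 where h: "h1 \<ge> g" "g \<ge> h2"
    "\<And>x. x\<^sup>2 + (- a - g) * x + (a * g - B) = (x - h1) * (x - h2)"
    by (rule monic_quadratic_roots) blast
  have "(x - a) * ((x - g) * (x - g)) - B * (x - g) = (x - h1) * (x - g) * (x - h2)" for x
  proof -
    have "(x - a) * ((x - g) * (x - g)) - B * (x - g)
        = (x - g) * (x\<^sup>2 + (- a - g) * x + (a * g - B))"
      by (simp add: power2_eq_square algebra_simps)
    then show ?thesis
      unfolding h(3) by (simp add: mult_ac)
  qed
  then show ?thesis
    using that[of h1 g h2] h eq by auto
next
  case False
  then have less: "\<mu>2 < \<mu>1"
    using assms by auto
  define p where "p x = (x - a) * ((x - \<mu>1) * (x - \<mu>2)) - B * (x - g)" for x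
  define A1 where "A1 = - a - \<mu>1 - \<mu>2"
  define A2 where "A2 = a * \<mu>1 + a * \<mu>2 + \<mu>1 * \<mu>2 - B"
  define A3 where "A3 = B * g - a * \<mu>1 * \<mu>2"
  have p: "p x = x ^ 3 + A1 * x\<^sup>2 + A2 * x + A3" for x
    by (simp add: p_def A1_def A2_def A3_def power2_eq_square power3_eq_cube algebra_simps)
  have p1: "p \<mu>1 \<le> 0" and p2: "p \<mu>2 \<ge> 0"
    using assms by (auto simp: p_def mult_nonneg_nonpos)
  obtain r where r: "r \<ge> \<mu>1" "p r = 0"
    using monic_cubic_root_ge[of \<mu>1 A1 A2 A3] p1 unfolding p by blast
  \<comment> \<open>The quotient of \<open>p\<close> by \<open>x - r\<close>, from synthetic
    division.\<close>
  define h where "h x = x\<^sup>2 + (A1 + r) * x + (A2 + r * (A1 + r))" for x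
  have ph: "p x = (x - r) * h x" for x
  proof -
    have "p x - p r = (x - r) * h x"
      unfolding p h_def by (simp add: power2_eq_square power3_eq_cube algebra_simps)
    then show ?thesis
      using r by simp
  qed
  have "h \<mu>2 \<le> 0"
    using p2 ph[of \<mu>2] less r by (simp add: zero_le_mult_iff)
  then obtain h1 h2 where hh: "h1 \<ge> \<mu>2" "\<mu>2 \<ge> h2" "\<And>x. h x = (x - h1) * (x - h2)"
    using monic_quadratic_roots[of \<mu>2 "A1 + r" "A2 + r * (A1 + r)"] unfolding h_def by blast
  have fac: "p x = (x - r) * (x - h1) * (x - h2)" for x
    using ph hh(3) by simp
  show ?thesis
  proof (cases "h1 \<le> \<mu>1")
    case True
    then show ?thesis
      using that[of r h1 h2] hh r fac by (simp add: p_def)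
  next
    \<comment> \<open>With both \<open>r\<close> and \<open>h1\<close> at or above
      \<open>\<mu>1\<close>, the factored form makes \<open>p \<mu>1\<close> nonnegative. Hence
      \<open>p \<mu>1 = 0\<close> and \<open>r = \<mu>1\<close>, so \<open>h1\<close> becomes the
      largest root and \<open>r\<close> the middle one.\<close>
    case False
    have "(\<mu>1 - r) * ((\<mu>1 - h1) * (\<mu>1 - h2)) \<le> 0"
      using p1 fac[of \<mu>1] by (simp add: mult.assoc)
    moreover have "(\<mu>1 - h1) * (\<mu>1 - h2) < 0"
      using False hh less by (intro mult_neg_pos) auto
    ultimately have "r = \<mu>1"
      using r by (auto simp: mult_le_0_iff)
    then show ?thesis
      using that[of h1 r h2] False hh less fac by (simp add: p_def mult_ac)
  qed
qed

text \<open>The i-th roots of \<open>p\<close> and \<open>r\<close> lie in the same interval cut out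
  by \<open>\<mu>1\<close> and \<open>\<mu>2\<close>, where \<open>q\<close> has constant sign. If a
  root increased, some point would give \<open>p\<close>, \<open>q\<close> and \<open>r\<close>
  signs incompatible with \<open>r = p + t * q\<close>.\<close>

lemma cubic_roots_antimono:
  fixes p q r :: "real \<Rightarrow> real"
  assumes r: "\<And>x. r x = p x + t * q x" and "t \<ge> 0"
    and q: "\<And>x. q x = (x - \<mu>1) * (x - \<mu>2)"
    and p: "\<And>x. p x = (x - l1) * (x - l2) * (x - l3)"
    and l: "l1 \<ge> \<mu>1" "\<mu>1 \<ge> l2" "l2 \<ge> \<mu>2" "\<mu>2 \<ge> l3"
    and k_fac: "\<And>x. r x = (x - k1) * (x - k2) * (x - k3)"
    and k: "k1 \<ge> \<mu>1" "\<mu>1 \<ge> k2" "k2 \<ge> \<mu>2" "\<mu>2 \<ge> k3"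
  shows "k1 \<le> l1 \<and> k2 \<le> l2 \<and> k3 \<le> l3"
proof (intro conjI)
  show "k1 \<le> l1"
  proof (rule ccontr)
    assume "\<not> k1 \<le> l1"
    then have "p k1 > 0" "q k1 \<ge> 0"
      using l k by (auto simp: p q)
    moreover have "r k1 = 0"
      by (simp add: k_fac)
    ultimately show False
      using r[of k1] \<open>t \<ge> 0\<close> mult_nonneg_nonneg[of t "q k1"] by linarith
  qed
  show "k2 \<le> l2"
  proof (rule ccontr)
    assume "\<not> k2 \<le> l2"
    \<comment> \<open>At \<open>k2\<close> or \<open>l2\<close> itself factors may vanish at an
      interval endpoint; the midpoint makes all three signs strict.\<close>
    define x where "x = (k2 + l2) / 2"
    have x: "l2 < x" "x < k2"
      using \<open>\<not> k2 \<le> l2\<close> by (auto simp: x_def)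
    have "p x < 0"
      using x l k unfolding p by (intro mult_neg_pos) auto
    moreover have "q x < 0"
      using x l k unfolding q by (intro mult_neg_pos) auto
    moreover have "r x > 0"
      using x l k unfolding k_fac by (intro mult_pos_pos mult_neg_neg) auto
    ultimately show False
      using r[of x] \<open>t \<ge> 0\<close> mult_nonneg_nonpos[of t "q x"] by linarith
  qed
  show "k3 \<le> l3"
  proof (rule ccontr)
    assume "\<not> k3 \<le> l3"
    then have "r l3 < 0"
      using l k unfolding k_fac by (intro mult_pos_neg mult_neg_neg) auto
    moreover have "q l3 \<ge> 0"
      using l unfolding q by (intro mult_nonpos_nonpos) auto
    moreover have "p l3 = 0"
      by (simp add: p)
    ultimately show False
      using r[of l3] \<open>t \<ge> 0\<close> mult_nonneg_nonneg[of t "q l3"] by linarith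
  qed
qed

section \<open>The eigenvalues of the symmetrised Jacobian\<close>

lemma det_2:
  fixes A :: "'a :: comm_ring_1 mat"
  assumes "A \<in> carrier_mat 2 2"
  shows "det A = A $$ (0,0) * A $$ (1,1) - A $$ (0,1) * A $$ (1,0)"
proof -
  have "det (mat_delete A 0 0) = A $$ (1,1)" "det (mat_delete A 0 1) = A $$ (1,0)"
    using assms by (subst det_single; auto simp: mat_delete_def)+
  then show ?thesis
    using assms by (subst laplace_expansion_row[of A 2 0]) (auto simp: numeral_2_eq_2 cofactor_def)
qed

lemma det_3:
  fixes A :: "'a :: comm_ring_1 mat"
  assumes "A \<in> carrier_mat 3 3"
  shows "det A = A $$ (0,0) * (A $$ (1,1) * A $$ (2,2) - A $$ (1,2) * A $$ (2,1))
    - A $$ (0,1) * (A $$ (1,0) * A $$ (2,2) - A $$ (1,2) * A $$ (2,0))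
    + A $$ (0,2) * (A $$ (1,0) * A $$ (2,1) - A $$ (1,1) * A $$ (2,0))"
proof -
  have "det (mat_delete A 0 0) = A $$ (1,1) * A $$ (2,2) - A $$ (1,2) * A $$ (2,1)"
    "det (mat_delete A 0 1) = A $$ (1,0) * A $$ (2,2) - A $$ (1,2) * A $$ (2,0)"
    "det (mat_delete A 0 2) = A $$ (1,0) * A $$ (2,1) - A $$ (1,1) * A $$ (2,0)"
    using assms by (subst det_2; auto simp: mat_delete_def numeral_2_eq_2)+
  then show ?thesis
    using assms
    by (subst laplace_expansion_row[of A 3 0])
       (auto simp: numeral_3_eq_3 numeral_2_eq_2 cofactor_def right_diff_distrib)
qed

text \<open>Expansion along the first row, whose third entry is zero. This is the bordered form with
  \<open>g = - \<gamma>\<close>; the squares come from the averaged off-diagonal entries.\<close>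

lemma poly_char_poly_chua:
  "poly (char_poly (sym_part (chua_jacobian \<alpha> \<beta> \<gamma> m0 m1 (x, y, z)))) s =
    (s - (\<alpha> * (m0 - 1) - 3 * \<alpha> * m1 * x\<^sup>2)) * ((s + 1) * (s + \<gamma>) - ((1 + \<beta>) / 2)\<^sup>2)
      - ((1 + \<alpha>) / 2)\<^sup>2 * (s + \<gamma>)"
proof -
  let ?A = "sym_part (chua_jacobian \<alpha> \<beta> \<gamma> m0 m1 (x, y, z))"
  have A: "?A \<in> carrier_mat 3 3"
    by (auto simp: sym_part_def mat_of_rows_list_def)
  then have dim: "dim_row ?A = 3" "dim_col ?A = 3"
    by auto
  show ?thesis
    unfolding char_poly_matrix[OF A] det_3[OF uminus_carrier_mat[OF char_matrix_closed[OF A]]]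
    by (simp add: char_matrix_def dim)
       (simp add: sym_part_def mat_of_rows_list_def numeral_2_eq_2 numeral_3_eq_3 field_simps power2_eq_square)
qed

text \<open>A real polynomial is determined by its values, so the pointwise factorisation from
  interlacing yields all roots with multiplicity.\<close>

lemma eigenvalues_desc_factored:
  assumes "\<And>x. poly (char_poly A) x = (x - l1) * (x - l2) * (x - l3)" "l1 \<ge> l2" "l2 \<ge> l3"
  shows "eigenvalues_desc A = [l1, l2, l3]"
proof -
  have "char_poly A = [:- l1, 1:] * [:- l2, 1:] * [:- l3, 1:]"
    unfolding poly_eq_poly_eq_iff[symmetric] using assms(1) by (auto simp: algebra_simps)
  then have "proots (char_poly A) = mset [l3, l2, l1]"
    by (simp only: proots_mult proots_linear_factor mult_eq_0_iff pCons_eq_0_iff one_neq_zero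
        simp_thms minus_minus) (simp add: add_mset_commute)
  then have "sorted_list_of_multiset (proots (char_poly A)) = [l3, l2, l1]"
    using assms(2,3) sorted_sort_id[of "[l3, l2, l1]"] by (simp add: sorted_list_of_multiset_mset)
  then show ?thesis
    by (simp add: eigenvalues_desc_def)
qed

theorem theorem1:
  fixes \<alpha> \<beta> \<gamma> m0 m1 :: real and u :: "real \<times> real \<times> real"
  assumes "\<alpha> * m1 > 0"
  shows "KY_dim (chua_eigenvalue \<alpha> \<beta> \<gamma> m0 m1 u) \<le> KY_dim (chua_eigenvalue \<alpha> \<beta> \<gamma> m0 m1 (0, 0, 0))"
proof -
  obtain x y z where u: "u = (x, y, z)"
    by (cases u) auto
  define t where "t = 3 * (\<alpha> * m1) * x\<^sup>2"
  define a where "a = \<alpha> * (m0 - 1)"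
  define B where "B = ((1 + \<alpha>) / 2)\<^sup>2"
  define q where "q s = (s + 1) * (s + \<gamma>) - ((1 + \<beta>) / 2)\<^sup>2" for s
  define P where "P v = poly (char_poly (sym_part (chua_jacobian \<alpha> \<beta> \<gamma> m0 m1 v)))" for v
  have "t \<ge> 0" "B \<ge> 0"
    using assms by (auto simp: t_def B_def)
  have Pu: "P u s = (s - (a - t)) * q s - B * (s - (- \<gamma>))" for s
    unfolding P_def u poly_char_poly_chua by (simp add: a_def t_def B_def q_def mult_ac)
  have P0: "P (0, 0, 0) s = (s - a) * q s - B * (s - (- \<gamma>))" for s
    unfolding P_def poly_char_poly_chua by (simp add: a_def B_def q_def)
  have q_monic: "q s = s\<^sup>2 + (1 + \<gamma>) * s + (\<gamma> - ((1 + \<beta>) / 2)\<^sup>2)" for s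
    by (simp add: q_def power2_eq_square algebra_simps)
  \<comment> \<open>At \<open>- \<gamma>\<close> only minus a square remains, so this diagonal entry
    separates the eigenvalues of the block, as interlacing requires of \<open>g\<close>.\<close>
  have "q (- \<gamma>) \<le> 0"
    by (simp add: q_def)
  then obtain \<mu>1 \<mu>2 where \<mu>: "\<mu>1 \<ge> - \<gamma>" "- \<gamma> \<ge> \<mu>2" "\<And>s. q s = (s - \<mu>1) * (s - \<mu>2)"
    unfolding q_monic by (rule monic_quadratic_roots) blast
  obtain l1 l2 l3 where l: "l1 \<ge> \<mu>1" "\<mu>1 \<ge> l2" "l2 \<ge> \<mu>2" "\<mu>2 \<ge> l3"
    and l_fac: "\<And>s. P (0, 0, 0) s = (s - l1) * (s - l2) * (s - l3)"
    using bordered_cubic_interlacing[OF \<mu>(1,2) \<open>B \<ge> 0\<close>, of a] unfolding P0 \<mu>(3) by blast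
  \<comment> \<open>The same \<open>\<mu>1\<close> and \<open>\<mu>2\<close> serve again, since
    \<open>q\<close> does not involve \<open>u\<close>; only \<open>a\<close> is shifted.\<close>
  obtain k1 k2 k3 where k: "k1 \<ge> \<mu>1" "\<mu>1 \<ge> k2" "k2 \<ge> \<mu>2" "\<mu>2 \<ge> k3"
    and k_fac: "\<And>s. P u s = (s - k1) * (s - k2) * (s - k3)"
    using bordered_cubic_interlacing[OF \<mu>(1,2) \<open>B \<ge> 0\<close>, of "a - t"] unfolding Pu \<mu>(3) by blast
  have "P u s = P (0, 0, 0) s + t * q s" for s
    unfolding Pu P0 by (simp add: algebra_simps)
  then have le: "k1 \<le> l1 \<and> k2 \<le> l2 \<and> k3 \<le> l3"
    by (rule cubic_roots_antimono[OF _ \<open>t \<ge> 0\<close> \<mu>(3) l_fac l k_fac k])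
  have "eigenvalues_desc (sym_part (chua_jacobian \<alpha> \<beta> \<gamma> m0 m1 u)) = [k1, k2, k3]"
    using k k_fac unfolding P_def by (intro eigenvalues_desc_factored) auto
  moreover have "eigenvalues_desc (sym_part (chua_jacobian \<alpha> \<beta> \<gamma> m0 m1 (0, 0, 0))) = [l1, l2, l3]"
    using l l_fac unfolding P_def by (intro eigenvalues_desc_factored) auto
  ultimately show ?thesis
    using le by (intro KY_dim_mono) (simp_all add: chua_eigenvalue_def)
qed

end
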